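(* Let $K$ be a compact Hausdorff space and let $\mathcal{S}\subset\mathcal{L}(C(K))$ be a right amenable semigroup of Markov operators. The mapping $$\mathcal{P}(\mathrm{Prim}(\mathcal{S}))\to\mathcal{P}(\mathrm{Prim}(\mathcal{S})),\quad A\mapsto\overline{A}:=\mathrm{hull}(\ker(A))$$ on the power set of $\mathrm{Prim}(\mathcal{S})$ defines a Kuratowski closure operator.
   Context: $C(K)$ is the Banach lattice of continuous complex-valued functions on $K$; its dual $C(K)'$ is identified with the complex regular Borel measures on $K$, with $\langle f,\mu\rangle=\int_K f\,d\mu$. $\mathcal{L}(C(K))$ denotes the bounded linear operators on $C(K)$; $T\in\mathcal{L}(C(K))$ is Markov if it is positive and $T\mathbf{1}=\mathbf{1}$. A semigroup $\mathcal{S}\subset\mathcal{L}(C(K))$ (under composition, with the strong operator topology) is right amenable if there is a positive $m\in C_b(\mathcal{S})'$ with $m(\mathbf{1})=1$ and $m(R_Sf)=m(f)$ for all $f\in C_b(\mathcal{S})$, $S\in\mathcal{S}$, where $(R_Sf)(T)=f(TS)$. $P_{\mathcal{S}}(K)$ is the set of probability measures $\mu\in C(K)'$ with $S'\mu=\mu$ for all $S\in\mathcal{S}$. For $\mu\in P_{\mathcal{S}}(K)$, let $I_\mu=\{f\in C(K): \langle |f|,\mu\rangle=0\}$; every $S\in\mathcal{S}$ induces (uniquely, by continuous extension) a bounded operator $S_\mu$ on $L^1(K,\mu)$, and $\mu$ is ergodic if the common fixed space of all $S_\mu$ ($S\in\mathcal{S}$) in $L^1(K,\mu)$ is one-dimensional.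 A primitive $\mathcal{S}$-ideal is an ideal of the form $I_\mu$ with $\mu\in P_{\mathcal{S}}(K)$ ergodic; $\mathrm{Prim}(\mathcal{S})$ is the set of primitive $\mathcal{S}$-ideals. For $A\subset\mathrm{Prim}(\mathcal{S})$ and $I\subset C(K)$: $\ker(A)=\bigcap_{p\in A}p$ (with $\ker(\emptyset)=C(K)$) and $\mathrm{hull}(I)=\{p\in\mathrm{Prim}(\mathcal{S}): I\subset p\}$. A Kuratowski closure operator on a set $X$ is a map $A\mapsto\overline A$ on the power set of $X$ with $\overline{\emptyset}=\emptyset$, $A\subset\overline A$, $\overline{\overline A}=\overline A$ and $\overline{A_1\cup A_2}=\overline{A_1}\cup\overline{A_2}$. *)

theory Defs
  imports "HOL-Analysis.Analysis" "HOL-Probability.Probability_Measure"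
begin

text \<open>
  The compact Hausdorff space is a type of class t2_space whose universe is assumed to be
  compact. On it every continuous function is bounded, so the Banach space of bounded continuous
  functions is the space C(K).
\<close>

type_synonym 'k CK = "'k \<Rightarrow>\<^sub>C complex"

type_synonym 'k CK_op = "'k CK \<Rightarrow>\<^sub>L 'k CK"

definition scaleC_CK :: "complex \<Rightarrow> 'k::topological_space CK \<Rightarrow> 'k CK" where
  "scaleC_CK c f = Bcontfun (\<lambda>x. c * apply_bcontfun f x)"

lemma apply_scaleC_CK [simp]: "apply_bcontfun (scaleC_CK c f) x = c * apply_bcontfun f x"
proof -
  have "bounded ((\<lambda>z. c * z) ` range (apply_bcontfun f))"
    by (rule bounded_linear_image[OF bounded_apply_bcontfun bounded_linear_mult_right])
  then have "(\<lambda>x. c * apply_bcontfun f x) \<in> bcontfun"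
    by (simp add: bcontfun_def image_image continuous_on_mult_left)
  then show ?thesis
    by (simp add: scaleC_CK_def Bcontfun_inverse)
qed

text \<open>
  The library's bounded linear maps are real-linear, so complex homogeneity is required separately.
\<close>

definition complex_operator :: "'k::t2_space CK_op \<Rightarrow> bool" where
  "complex_operator T \<longleftrightarrow>
     (\<forall>c f. blinfun_apply T (scaleC_CK c f) = scaleC_CK c (blinfun_apply T f))"

definition nonneg_CK :: "'k::t2_space CK \<Rightarrow> bool" where
  "nonneg_CK f \<longleftrightarrow> (\<forall>x. apply_bcontfun f x \<in> \<real>\<^sub>\<ge>\<^sub>0)"

definition positive_operator :: "'k::t2_space CK_op \<Rightarrow> bool" where
  "positive_operator T \<longleftrightarrow> (\<forall>f. nonneg_CK f \<longrightarrow> nonneg_CK (blinfun_apply T f))"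

definition Markov_operator :: "'k::t2_space CK_op \<Rightarrow> bool" where
  "Markov_operator T \<longleftrightarrow>
     complex_operator T \<and> positive_operator T \<and>
     blinfun_apply T (const_bcontfun 1) = const_bcontfun 1"

definition operator_semigroup :: "'k::t2_space CK_op set \<Rightarrow> bool" where
  "operator_semigroup S \<longleftrightarrow> (\<forall>T\<in>S. \<forall>U\<in>S. T o\<^sub>L U \<in> S)"

text \<open>
  Elements of \<open>C\<^sub>b(S)\<close> are represented by functions on all operators, of which only the values on
  \<open>S\<close> matter. Functionals on \<open>C\<^sub>b(S)\<close> respect this: linearity and the bound below by the supremum
  over \<open>S\<close> force functions that agree on \<open>S\<close> to have the same image.
\<close>

definition Cb :: "'k::t2_space CK_op set \<Rightarrow> ('k CK_op \<Rightarrow> complex) set" where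
  "Cb S = {f. continuous_map (subtopology strong_operator_topology S) euclidean f \<and>
              bounded (f ` S)}"

definition Cb_dual :: "'k::t2_space CK_op set \<Rightarrow> (('k CK_op \<Rightarrow> complex) \<Rightarrow> complex) set" where
  "Cb_dual S = {m.
     (\<forall>f\<in>Cb S. \<forall>g\<in>Cb S. m (\<lambda>T. f T + g T) = m f + m g) \<and>
     (\<forall>c. \<forall>f\<in>Cb S. m (\<lambda>T. c * f T) = c * m f) \<and>
     (\<exists>B. \<forall>f\<in>Cb S. cmod (m f) \<le> B * (SUP T\<in>S. cmod (f T)))}"

definition right_amenable :: "'k::t2_space CK_op set \<Rightarrow> bool" where
  "right_amenable S \<longleftrightarrow>
     (\<exists>m\<in>Cb_dual S.
        (\<forall>f\<in>Cb S. (\<forall>T\<in>S. f T \<in> \<real>\<^sub>\<ge>\<^sub>0) \<longrightarrow> m f \<in> \<real>\<^sub>\<ge>\<^sub>0) \<and>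
        m (\<lambda>_. 1) = 1 \<and>
        (\<forall>f\<in>Cb S. \<forall>U\<in>S. m (\<lambda>T. f (T o\<^sub>L U)) = m f))"

definition regular_borel_measure :: "'k::t2_space measure \<Rightarrow> bool" where
  "regular_borel_measure M \<longleftrightarrow>
     sets M = sets borel \<and>
     (\<forall>A\<in>sets borel.
        emeasure M A = (SUP C\<in>{C. compact C \<and> C \<subseteq> A}. emeasure M C) \<and>
        emeasure M A = (INF U\<in>{U. open U \<and> A \<subseteq> U}. emeasure M U))"

definition pairing :: "'k::t2_space CK \<Rightarrow> 'k measure \<Rightarrow> complex" where
  "pairing f M = (LINT x|M. apply_bcontfun f x)"

text \<open>
  Under the identification of measures with functionals, invariance of \<open>M\<close> under the adjoint of \<open>T\<close>
  says that \<open>pairing (T f) M = pairing f M\<close> for all \<open>f\<close>.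
\<close>

definition invariant_probs :: "'k::t2_space CK_op set \<Rightarrow> 'k measure set" where
  "invariant_probs S =
     {M. prob_space M \<and> regular_borel_measure M \<and>
         (\<forall>T\<in>S. \<forall>f. pairing (blinfun_apply T f) M = pairing f M)}"

definition ideal_of :: "'k::t2_space measure \<Rightarrow> 'k CK set" where
  "ideal_of M = {f. (LINT x|M. cmod (apply_bcontfun f x)) = 0}"

text \<open>
  \<open>L\<^sup>1(K,M)\<close> is handled through its representatives, the integrable functions, with equality almost
  everywhere. The operator induced by \<open>T\<close> is the extension by continuity: if \<open>f\<^sub>n \<rightarrow> g\<close> in \<open>L\<^sup>1\<close> with
  continuous \<open>f\<^sub>n\<close>, then \<open>g\<close> is sent to the \<open>L\<^sup>1\<close>-limit of \<open>T f\<^sub>n\<close>. For a Markov operator \<open>T\<close> and a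
  regular \<open>T\<close>-invariant probability measure \<open>M\<close> this limit exists for every integrable \<open>g\<close> and is
  unique almost everywhere, so the choice below is only one of a representative.
\<close>

definition L1_tendsto ::
  "'k::t2_space measure \<Rightarrow> (nat \<Rightarrow> 'k \<Rightarrow> complex) \<Rightarrow> ('k \<Rightarrow> complex) \<Rightarrow> bool" where
  "L1_tendsto M u g \<longleftrightarrow> (\<lambda>n. LINT x|M. cmod (u n x - g x)) \<longlonglongrightarrow> 0"

definition L1_operator ::
  "'k::t2_space measure \<Rightarrow> 'k CK_op \<Rightarrow> ('k \<Rightarrow> complex) \<Rightarrow> ('k \<Rightarrow> complex)" where
  "L1_operator M T g = (SOME h. integrable M h \<and>
     (\<exists>f :: nat \<Rightarrow> 'k CK.
        L1_tendsto M (\<lambda>n. apply_bcontfun (f n)) g \<and>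
        L1_tendsto M (\<lambda>n. apply_bcontfun (blinfun_apply T (f n))) h))"

definition L1_fixed_space :: "'k::t2_space CK_op set \<Rightarrow> 'k measure \<Rightarrow> ('k \<Rightarrow> complex) set" where
  "L1_fixed_space S M =
     {g. integrable M g \<and> (\<forall>T\<in>S. AE x in M. L1_operator M T g x = g x)}"

text \<open>Ergodicity: the fixed space has complex dimension one modulo almost everywhere equality.\<close>

definition ergodic :: "'k::t2_space CK_op set \<Rightarrow> 'k measure \<Rightarrow> bool" where
  "ergodic S M \<longleftrightarrow>
     (\<exists>g\<in>L1_fixed_space S M.
        \<not> (AE x in M. g x = 0) \<and>
        (\<forall>h\<in>L1_fixed_space S M. \<exists>c. AE x in M. h x = c * g x))"

definition Prim :: "'k::t2_space CK_op set \<Rightarrow> 'k CK set set" where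
  "Prim S = {ideal_of M |M. M \<in> invariant_probs S \<and> ergodic S M}"

definition prim_ker :: "'k::t2_space CK set set \<Rightarrow> 'k CK set" where
  "prim_ker A = \<Inter>A"

definition prim_hull :: "'k::t2_space CK_op set \<Rightarrow> 'k CK set \<Rightarrow> 'k CK set set" where
  "prim_hull S I = {p \<in> Prim S. I \<subseteq> p}"

definition Kuratowski_closure_operator :: "'a set \<Rightarrow> ('a set \<Rightarrow> 'a set) \<Rightarrow> bool" where
  "Kuratowski_closure_operator X cl \<longleftrightarrow>
     (\<forall>A. A \<subseteq> X \<longrightarrow> cl A \<subseteq> X) \<and>
     cl {} = {} \<and>
     (\<forall>A. A \<subseteq> X \<longrightarrow> A \<subseteq> cl A) \<and>
     (\<forall>A. A \<subseteq> X \<longrightarrow> cl (cl A) = cl A) \<and>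
     (\<forall>A B. A \<subseteq> X \<longrightarrow> B \<subseteq> X \<longrightarrow> cl (A \<union> B) = cl A \<union> cl B)"

end

theory Submission
  imports Defs
begin

text \<open>
  Only the inclusion of the closure of a union in the union of the closures is not formal. It says
  that a primitive ideal \<open>p = I\<^sub>\<mu>\<close> is prime: if it contains \<open>I \<inter> J\<close>, where \<open>I\<close> and \<open>J\<close> are kernels,
  then it contains \<open>I\<close> or \<open>J\<close>. Let \<open>h\<close> be the limit of an increasing sequence of functions
  \<open>0 \<le> f\<^sub>n \<le> 1\<close> in \<open>I\<close> whose \<open>\<mu>\<close>-integrals tend to the largest possible value. For \<open>T \<in> S\<close> the functions
  \<open>T f\<^sub>n\<close> lie in \<open>I\<close> again, so \<open>T f\<^sub>n \<le> h\<close> almost everywhere by maximality; as they have the same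
  integrals as \<open>f\<^sub>n\<close>, they converge to \<open>h\<close> in \<open>L\<^sup>1\<close>. Hence \<open>h\<close> is fixed, and so it is a constant by
  ergodicity, positive unless \<open>I \<subseteq> p\<close>. If neither \<open>I\<close> nor \<open>J\<close> were contained in \<open>p\<close>, the minimum of
  the two sequences would lie in \<open>I \<inter> J \<subseteq> p\<close>, yet converge to a positive constant.
\<close>

section \<open>Markov operators\<close>

text \<open>\<open>Bcontfun\<close> is meaningful only on bounded continuous functions, so values
  are always computed through \<open>apply_CK_of_real\<close>, which asks for continuity and a
  bound.\<close>

definition CK_of_real :: "('k::t2_space \<Rightarrow> real) \<Rightarrow> 'k CK" where
  "CK_of_real u = Bcontfun (\<lambda>x. complex_of_real (u x))"

lemma apply_CK_of_real:
  assumes "continuous_on UNIV u" "\<And>x. \<bar>u x\<bar> \<le> B"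
  shows "apply_bcontfun (CK_of_real u) x = complex_of_real (u x)"
proof -
  have "(\<lambda>x. complex_of_real (u x)) \<in> bcontfun"
    using assms by (intro bcontfun_normI[where b=B]) (auto intro!: continuous_intros)
  then show ?thesis
    by (simp add: CK_of_real_def Bcontfun_inverse)
qed

lemma continuous_on_apply_bcontfun_UNIV: "continuous_on UNIV (apply_bcontfun f)"
  using apply_bcontfun[of f] by (simp add: bcontfun_def)

lemma apply_CK_of_real_cmod [simp]:
  "apply_bcontfun (CK_of_real (\<lambda>x. cmod (apply_bcontfun f x))) x = cmod (apply_bcontfun f x)"
  by (rule apply_CK_of_real[where B="norm f"])
     (auto intro!: continuous_intros continuous_on_apply_bcontfun_UNIV norm_bounded)

lemma apply_CK_of_real_Re [simp]:
  "apply_bcontfun (CK_of_real (\<lambda>x. Re (apply_bcontfun f x))) x = Re (apply_bcontfun f x)"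
  by (rule apply_CK_of_real[where B="norm f"])
     (auto intro!: continuous_intros continuous_on_apply_bcontfun_UNIV
       order_trans[OF abs_Re_le_cmod norm_bounded])

lemma apply_CK_of_real_Im [simp]:
  "apply_bcontfun (CK_of_real (\<lambda>x. Im (apply_bcontfun f x))) x = Im (apply_bcontfun f x)"
  by (rule apply_CK_of_real[where B="norm f"])
     (auto intro!: continuous_intros continuous_on_apply_bcontfun_UNIV
       order_trans[OF abs_Im_le_cmod norm_bounded])

lemma Markov_operator_mono:
  assumes "Markov_operator T" "\<And>x. apply_bcontfun g x - apply_bcontfun f x \<in> \<real>\<^sub>\<ge>\<^sub>0"
  shows "apply_bcontfun (blinfun_apply T g) x - apply_bcontfun (blinfun_apply T f) x \<in> \<real>\<^sub>\<ge>\<^sub>0"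
proof -
  have "nonneg_CK (g - f)"
    using assms(2) by (simp add: nonneg_CK_def)
  then have "nonneg_CK (blinfun_apply T (g - f))"
    using assms(1) by (simp add: Markov_operator_def positive_operator_def)
  then show ?thesis
    by (simp add: nonneg_CK_def blinfun.diff_right)
qed

lemma Markov_operator_const:
  assumes "Markov_operator T"
  shows "blinfun_apply T (const_bcontfun c) = const_bcontfun c"
proof -
  have "const_bcontfun c = scaleC_CK c (const_bcontfun 1)"
    by (rule bcontfun_eqI) simp
  moreover from this have "blinfun_apply T (const_bcontfun c) = scaleC_CK c (const_bcontfun 1)"
    using assms by (metis Markov_operator_def complex_operator_def)
  ultimately show ?thesis
    by metis
qed

text \<open>Positivity speaks of nonnegative functions only, but \<open>norm f\<close> minus the
  real function \<open>f\<close> is one. Its image is the constant \<open>norm f\<close> minus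
  \<open>T f\<close>, which is therefore real.\<close>

lemma Markov_operator_real:
  assumes "Markov_operator T" "\<And>x. apply_bcontfun f x = complex_of_real (u x)"
  shows "apply_bcontfun (blinfun_apply T f) x \<in> \<real>"
proof -
  let ?b = "complex_of_real (norm f)"
  have "apply_bcontfun (const_bcontfun ?b) x - apply_bcontfun f x \<in> \<real>\<^sub>\<ge>\<^sub>0" for x
  proof -
    have "\<bar>u x\<bar> \<le> norm f"
      using norm_bounded[of f x] assms(2) by simp
    then show ?thesis
      by (simp add: assms(2) complex_nonneg_Reals_iff)
  qed
  then have "apply_bcontfun (blinfun_apply T (const_bcontfun ?b)) x
      - apply_bcontfun (blinfun_apply T f) x \<in> \<real>\<^sub>\<ge>\<^sub>0"
    by (rule Markov_operator_mono[OF assms(1)])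
  then show ?thesis
    by (simp add: Markov_operator_const[OF assms(1)] complex_nonneg_Reals_iff complex_is_Real_iff)
qed

text \<open>Splitting \<open>f\<close> into real and imaginary parts and using complex homogeneity,
  the images of both parts are real, so they are the real and imaginary parts of
  \<open>T f\<close>.\<close>

lemma Markov_operator_Re:
  assumes "Markov_operator T"
  shows "apply_bcontfun (blinfun_apply T (CK_of_real (\<lambda>x. Re (apply_bcontfun f x)))) x
    = Re (apply_bcontfun (blinfun_apply T f) x)"
proof -
  let ?r = "CK_of_real (\<lambda>x. Re (apply_bcontfun f x))"
  let ?i = "CK_of_real (\<lambda>x. Im (apply_bcontfun f x))"
  have "f = ?r + scaleC_CK \<i> ?i"
    by (rule bcontfun_eqI) (simp add: complex_eq)
  then have "blinfun_apply T f = blinfun_apply T ?r + scaleC_CK \<i> (blinfun_apply T ?i)"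
    using assms by (metis Markov_operator_def blinfun.add_right complex_operator_def)
  then have "apply_bcontfun (blinfun_apply T f) x
      = apply_bcontfun (blinfun_apply T ?r) x + \<i> * apply_bcontfun (blinfun_apply T ?i) x"
    by simp
  moreover have "apply_bcontfun (blinfun_apply T ?r) x \<in> \<real>"
    by (rule Markov_operator_real[OF assms]) simp
  moreover have "apply_bcontfun (blinfun_apply T ?i) x \<in> \<real>"
    by (rule Markov_operator_real[OF assms]) simp
  ultimately show ?thesis
    by (simp add: complex_is_Real_iff complex_eq_iff)
qed

text \<open>This is |T f| \<le> T|f|, by rotation: a unimodular factor makes the value of
  \<open>T f\<close> at the given point nonnegative, and Re(c f) \<le> |f| holds everywhere.
  \<open>Re\<close> on the right only changes the type of a real value.\<close>

lemma cmod_Markov_operator_le: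
  assumes "Markov_operator T"
  shows "cmod (apply_bcontfun (blinfun_apply T f) x)
    \<le> Re (apply_bcontfun (blinfun_apply T (CK_of_real (\<lambda>x. cmod (apply_bcontfun f x)))) x)"
proof -
  let ?z = "apply_bcontfun (blinfun_apply T f) x"
  obtain c where c: "cmod c = 1" "c * ?z = complex_of_real (cmod ?z)"
  proof (cases "?z = 0")
    case True
    then show ?thesis
      by (intro that[of 1]) auto
  next
    case False
    then show ?thesis
      by (intro that[of "cnj ?z / cmod ?z"])
         (auto simp: norm_divide complex_norm_square[symmetric] power2_eq_square mult.commute)
  qed
  let ?w = "scaleC_CK c f"
  have "blinfun_apply T ?w = scaleC_CK c (blinfun_apply T f)"
    using assms by (simp add: Markov_operator_def complex_operator_def)
  then have Tw: "apply_bcontfun (blinfun_apply T ?w) x = complex_of_real (cmod ?z)"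
    using c by simp
  have "apply_bcontfun (CK_of_real (\<lambda>x. cmod (apply_bcontfun f x))) y
      - apply_bcontfun (CK_of_real (\<lambda>x. Re (apply_bcontfun ?w x))) y \<in> \<real>\<^sub>\<ge>\<^sub>0" for y
    unfolding apply_CK_of_real_cmod apply_CK_of_real_Re
    using complex_Re_le_cmod[of "c * apply_bcontfun f y"] c(1)
    by (simp add: complex_nonneg_Reals_iff norm_mult del: complex_Re_le_cmod)
  from Markov_operator_mono[OF assms this, of x] show ?thesis
    by (simp add: Markov_operator_Re[OF assms] Tw complex_nonneg_Reals_iff del: apply_scaleC_CK)
qed

section \<open>Invariant measures and the induced operators\<close>

lemma borel_measurable_bcontfun:
  "sets M = sets borel \<Longrightarrow> apply_bcontfun (f :: 'k::t2_space CK) \<in> borel_measurable M"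
  using borel_measurable_continuous_onI[OF continuous_on_apply_bcontfun_UNIV]
  by (metis measurable_cong_sets)

lemma integrable_bcontfun:
  fixes f :: "'k::t2_space CK"
  assumes "prob_space M" "sets M = sets borel"
  shows "integrable M (apply_bcontfun f)"
proof -
  interpret prob_space M by fact
  show ?thesis
    using assms(2) by (intro integrable_const_bound[where B="norm f"])
      (auto intro: borel_measurable_bcontfun norm_bounded)
qed

lemma ideal_of_iff:
  assumes "prob_space M" "sets M = sets borel"
  shows "f \<in> ideal_of M \<longleftrightarrow> (AE x in M. apply_bcontfun f x = 0)"
  using integral_nonneg_eq_0_iff_AE[OF integrable_norm[OF integrable_bcontfun[OF assms, of f]]]
  by (simp add: ideal_of_def)

lemma invariant_probsD:
  assumes "M \<in> invariant_probs S"
  shows "prob_space M" "sets M = sets borel"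
    "T \<in> S \<Longrightarrow> pairing (blinfun_apply T f) M = pairing f M"
  using assms by (auto simp: invariant_probs_def regular_borel_measure_def)

text \<open>Integrating |T f| \<le> T|f| and applying invariance to |f| makes \<open>T\<close> a
  contraction for the L1 seminorm.\<close>

lemma integral_cmod_Markov_operator_le:
  assumes "M \<in> invariant_probs S" "T \<in> S" "Markov_operator T"
  shows "(LINT x|M. cmod (apply_bcontfun (blinfun_apply T f) x))
    \<le> (LINT x|M. cmod (apply_bcontfun f x))"
proof -
  let ?a = "CK_of_real (\<lambda>x. cmod (apply_bcontfun f x))"
  note int = integrable_bcontfun[OF invariant_probsD(1,2)[OF assms(1)]]
  have "(LINT x|M. cmod (apply_bcontfun (blinfun_apply T f) x))
      \<le> (LINT x|M. Re (apply_bcontfun (blinfun_apply T ?a) x))"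
    using int by (intro integral_mono integrable_norm integrable_Re cmod_Markov_operator_le assms)
  also have "\<dots> = Re (pairing (blinfun_apply T ?a) M)"
    unfolding pairing_def by (intro integral_Re int)
  also have "\<dots> = Re (pairing ?a M)"
    using invariant_probsD(3)[OF assms(1,2)] by simp
  also have "\<dots> = (LINT x|M. cmod (apply_bcontfun f x))"
    by (simp add: pairing_def)
  finally show ?thesis .
qed

lemma ideal_of_invariant:
  assumes "M \<in> invariant_probs S" "T \<in> S" "Markov_operator T" "f \<in> ideal_of M"
  shows "blinfun_apply T f \<in> ideal_of M"
proof -
  have "(LINT x|M. cmod (apply_bcontfun (blinfun_apply T f) x)) \<le> 0"
    using integral_cmod_Markov_operator_le[OF assms(1-3), of f] assms(4)
    by (simp add: ideal_of_def)
  moreover have "(LINT x|M. cmod (apply_bcontfun (blinfun_apply T f) x)) \<ge> 0"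
    by simp
  ultimately show ?thesis
    unfolding ideal_of_def by simp
qed

text \<open>Integrability is assumed throughout because the integral of a nonintegrable function is
  0 by default.\<close>

lemma integral_cmod_triangle:
  fixes a b c :: "'a \<Rightarrow> complex"
  assumes "integrable M a" "integrable M b" "integrable M c"
  shows "(LINT x|M. cmod (a x - c x)) \<le> (LINT x|M. cmod (a x - b x)) + (LINT x|M. cmod (b x - c x))"
proof -
  have "(LINT x|M. cmod (a x - c x)) \<le> (LINT x|M. cmod (a x - b x) + cmod (b x - c x))"
    using assms norm_triangle_ineq[of "a x - b x" "b x - c x" for x]
    by (intro integral_mono integrable_norm Bochner_Integration.integrable_add
        Bochner_Integration.integrable_diff) auto
  then show ?thesis
    using assms by (simp add: Bochner_Integration.integral_add)
qed

text \<open>Contractivity forces the images of two sequences with the same L1 limit to approach each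
  other. Hence the choice in \<open>L1_operator\<close> is determined up to null sets.\<close>

lemma L1_limit_unique:
  assumes M: "M \<in> invariant_probs S" "T \<in> S" "Markov_operator T"
    and int: "integrable M g" "integrable M h" "integrable M h'"
    and f: "L1_tendsto M (\<lambda>n. apply_bcontfun (f n)) g"
      "L1_tendsto M (\<lambda>n. apply_bcontfun (blinfun_apply T (f n))) h"
    and f': "L1_tendsto M (\<lambda>n. apply_bcontfun (f' n)) g"
      "L1_tendsto M (\<lambda>n. apply_bcontfun (blinfun_apply T (f' n))) h'"
  shows "AE x in M. h x = h' x"
proof -
  note intc = integrable_bcontfun[OF invariant_probsD(1,2)[OF M(1)]]
  define d where "d u v = (LINT x|M. cmod (u x - v x))" for u v :: "'a \<Rightarrow> complex"
  have tri: "d u w \<le> d u v + d v w" if "integrable M u" "integrable M v" "integrable M w" for u v w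
    unfolding d_def using integral_cmod_triangle that by blast
  have sym: "d u v = d v u" for u v
    unfolding d_def by (simp add: norm_minus_commute)
  have contr: "d (apply_bcontfun (blinfun_apply T u)) (apply_bcontfun (blinfun_apply T v))
      \<le> d (apply_bcontfun u) (apply_bcontfun v)" for u v
    using integral_cmod_Markov_operator_le[OF M, of "u - v"]
    by (simp add: d_def blinfun.diff_right)
  \<comment> \<open>The path from \<open>h\<close> to \<open>h'\<close> runs through
    \<open>T (f n)\<close> and \<open>T (f' n)\<close>; by contractivity its middle leg is at most
    the way from \<open>f n\<close> through \<open>g\<close> to \<open>f' n\<close>.\<close>
  let ?e = "\<lambda>n. d (apply_bcontfun (blinfun_apply T (f n))) h + (d (apply_bcontfun (f n)) g
      + d (apply_bcontfun (f' n)) g) + d (apply_bcontfun (blinfun_apply T (f' n))) h'"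
  have "d h h' \<le> ?e n" for n
    using tri[OF int(2) intc int(3), of "blinfun_apply T (f n)"]
      tri[OF intc intc int(3), of "blinfun_apply T (f n)" "blinfun_apply T (f' n)"]
      tri[OF intc int(1) intc, of "f n" "f' n"] contr[of "f n" "f' n"]
    by (simp add: sym[of h] sym[of g])
  moreover have "?e \<longlonglongrightarrow> 0 + (0 + 0) + 0"
    using f f' unfolding L1_tendsto_def d_def by (intro tendsto_add)
  ultimately have "d h h' \<le> 0"
    by (intro LIMSEQ_le_const[of ?e]) auto
  moreover have "d h h' \<ge> 0"
    unfolding d_def by simp
  ultimately have "(LINT x|M. cmod (h x - h' x)) = 0"
    unfolding d_def by simp
  then show ?thesis
    using integral_nonneg_eq_0_iff_AE[of M "\<lambda>x. cmod (h x - h' x)"] int by simp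
qed

text \<open>The limit \<open>g\<close> is itself an admissible value for the choice in
  \<open>L1_operator\<close>, so the chosen value exists, and uniqueness of the limit identifies it
  with \<open>g\<close>.\<close>

lemma L1_fixed_spaceI:
  assumes M: "M \<in> invariant_probs S" "\<forall>T\<in>S. Markov_operator T"
    and int: "integrable M g"
    and lim: "L1_tendsto M (\<lambda>n. apply_bcontfun (f n)) g"
      "\<And>T. T \<in> S \<Longrightarrow> L1_tendsto M (\<lambda>n. apply_bcontfun (blinfun_apply T (f n))) g"
  shows "g \<in> L1_fixed_space S M"
proof -
  have "AE x in M. L1_operator M T g x = g x" if T: "T \<in> S" for T
  proof -
    let ?P = "\<lambda>h. integrable M h \<and> (\<exists>f :: nat \<Rightarrow> 'a CK.
      L1_tendsto M (\<lambda>n. apply_bcontfun (f n)) g \<and>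
      L1_tendsto M (\<lambda>n. apply_bcontfun (blinfun_apply T (f n))) h)"
    have "?P g"
      using int lim T by blast
    then have "?P (L1_operator M T g)"
      unfolding L1_operator_def by (rule someI[of ?P])
    then show ?thesis
      using L1_limit_unique[OF M(1) T _ int _ int _ _ lim(1) lim(2)[OF T]] M(2) T by blast
  qed
  then show ?thesis
    using int by (simp add: L1_fixed_space_def)
qed

text \<open>Constants are fixed by Markov operators, so they span a fixed space of dimension
  one.\<close>

lemma ergodic_constant:
  assumes M: "M \<in> invariant_probs S" "\<forall>T\<in>S. Markov_operator T" "ergodic S M"
    and h: "h \<in> L1_fixed_space S M"
  shows "\<exists>c. AE x in M. h x = c"
proof -
  interpret prob_space M
    using M(1) by (rule invariant_probsD)
  have "(\<lambda>_. 1) \<in> L1_fixed_space S M"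
    by (rule L1_fixed_spaceI[OF M(1,2), where f="\<lambda>_. const_bcontfun 1"])
       (use M(2) in \<open>auto simp: L1_tendsto_def Markov_operator_const\<close>)
  moreover obtain g where
    g: "\<And>h. h \<in> L1_fixed_space S M \<Longrightarrow> \<exists>c. AE x in M. h x = c * g x"
    using M(3) unfolding ergodic_def by blast
  ultimately obtain a where a: "AE x in M. 1 = a * g x"
    by blast
  obtain b where b: "AE x in M. h x = b * g x"
    using g[OF h] by blast
  from a b have "AE x in M. h x = b / a"
  proof eventually_elim
    case (elim x)
    then have "a \<noteq> 0"
      by auto
    with elim show ?case
      by (simp add: field_simps)
  qed
  then show ?thesis ..
qed

section \<open>Primitive ideals are prime\<close>

text \<open>The functions are kept real-valued so that maxima, minima and ordered integrals are
  available; the bound 1 supplies finite suprema and a dominating function.\<close>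

definition unit_part :: "'k::t2_space CK set \<Rightarrow> ('k \<Rightarrow> real) set" where
  "unit_part I = {u. (\<forall>x. 0 \<le> u x \<and> u x \<le> 1) \<and>
     (\<exists>f\<in>I. \<forall>x. apply_bcontfun f x = complex_of_real (u x))}"

lemma unit_partD:
  assumes "u \<in> unit_part I"
  shows "0 \<le> u x" "u x \<le> 1" "continuous_on UNIV u" "CK_of_real u \<in> I"
    "apply_bcontfun (CK_of_real u) x = complex_of_real (u x)"
proof -
  obtain f where f: "f \<in> I" "\<And>x. apply_bcontfun f x = complex_of_real (u x)"
    using assms by (auto simp: unit_part_def)
  show u: "0 \<le> u x" "u x \<le> 1" for x
    using assms by (auto simp: unit_part_def)
  have "u = (\<lambda>x. Re (apply_bcontfun f x))"
    using f by simp
  then show cont: "continuous_on UNIV u"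
    by (simp add: continuous_on_Re continuous_on_apply_bcontfun_UNIV)
  show ap: "apply_bcontfun (CK_of_real u) x = complex_of_real (u x)" for x
    by (rule apply_CK_of_real[OF cont, of 1]) (use u in \<open>simp add: abs_le_iff order_trans[OF _ u(1)]\<close>)
  have "CK_of_real u = f"
    by (rule bcontfun_eqI) (simp add: ap f)
  then show "CK_of_real u \<in> I"
    using f by simp
qed

lemma unit_partI:
  assumes "continuous_on UNIV u" "\<And>x. 0 \<le> u x" "\<And>x. u x \<le> 1" "CK_of_real u \<in> I"
  shows "u \<in> unit_part I"
proof -
  have "apply_bcontfun (CK_of_real u) x = complex_of_real (u x)" for x
    by (rule apply_CK_of_real[OF assms(1), of 1])
      (use assms(2,3) in \<open>simp add: abs_le_iff order_trans[OF _ assms(2)]\<close>)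
  then show ?thesis
    unfolding unit_part_def using assms by auto
qed

lemma unit_part_integrable:
  assumes "prob_space M" "sets M = sets borel" "u \<in> unit_part I"
  shows "integrable M u"
  using integrable_Re[OF integrable_bcontfun[OF assms(1,2), of "CK_of_real u"]]
  by (simp add: unit_partD(5)[OF assms(3)])

text \<open>The kernel is given by measures instead of ideals, so that membership becomes vanishing
  almost everywhere. Both kernels in the primality argument are instances.\<close>

locale Markov_kernel =
  fixes S :: "'k::t2_space CK_op set" and N :: "'k measure set"
  assumes Markov: "\<forall>T\<in>S. Markov_operator T"
    and invariant: "N \<subseteq> invariant_probs S"
begin

definition I where "I = (\<Inter>\<nu>\<in>N. ideal_of \<nu>)"

lemma mem_I_iff: "f \<in> I \<longleftrightarrow> (\<forall>\<nu>\<in>N. AE x in \<nu>. apply_bcontfun f x = 0)"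
proof -
  have "f \<in> ideal_of \<nu> \<longleftrightarrow> (AE x in \<nu>. apply_bcontfun f x = 0)" if "\<nu> \<in> N" for \<nu>
    using invariant that by (intro ideal_of_iff invariant_probsD(1,2)) auto
  then show ?thesis
    by (simp add: I_def)
qed

text \<open>The kernel is an order ideal. Since \<open>v\<close> need not belong to it, the minimum
  of functions from two kernels lies in both.\<close>

lemma unit_part_minI:
  assumes "u \<in> unit_part I" "continuous_on UNIV v" "\<And>x. 0 \<le> v x"
  shows "(\<lambda>x. min (u x) (v x)) \<in> unit_part I"
proof (rule unit_partI)
  show cont: "continuous_on UNIV (\<lambda>x. min (u x) (v x))"
    using unit_partD(3)[OF assms(1)] assms(2) by (intro continuous_intros)
  show b: "0 \<le> min (u x) (v x)" "min (u x) (v x) \<le> 1" for x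
    using unit_partD(1,2)[OF assms(1), of x] assms(3)[of x] by auto
  have ap: "apply_bcontfun (CK_of_real (\<lambda>x. min (u x) (v x))) x = complex_of_real (min (u x) (v x))"
    for x by (rule apply_CK_of_real[OF cont, of 1]) (simp only: abs_of_nonneg[OF b(1)] b(2))
  have "AE x in \<nu>. u x = 0" if "\<nu> \<in> N" for \<nu>
    using unit_partD(4,5)[OF assms(1)] that by (simp add: mem_I_iff)
  then have "AE x in \<nu>. min (u x) (v x) = 0" if "\<nu> \<in> N" for \<nu>
    by (rule eventually_mono) (simp_all add: that assms(3) min_absorb1)
  then show "CK_of_real (\<lambda>x. min (u x) (v x)) \<in> I"
    unfolding mem_I_iff ap by simp
qed

lemma unit_part_max:
  assumes "u \<in> unit_part I" "v \<in> unit_part I"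
  shows "(\<lambda>x. max (u x) (v x)) \<in> unit_part I"
proof (rule unit_partI)
  show cont: "continuous_on UNIV (\<lambda>x. max (u x) (v x))"
    using unit_partD(3)[OF assms(1)] unit_partD(3)[OF assms(2)] by (intro continuous_intros)
  show b: "0 \<le> max (u x) (v x)" "max (u x) (v x) \<le> 1" for x
    using unit_partD(1,2)[OF assms(1), of x] unit_partD(1,2)[OF assms(2), of x] by auto
  have ap: "apply_bcontfun (CK_of_real (\<lambda>x. max (u x) (v x))) x = complex_of_real (max (u x) (v x))"
    for x by (rule apply_CK_of_real[OF cont, of 1]) (simp only: abs_of_nonneg[OF b(1)] b(2))
  have zero: "AE x in \<nu>. u x = 0" "AE x in \<nu>. v x = 0" if "\<nu> \<in> N" for \<nu>
    using unit_partD(4,5)[OF assms(1)] unit_partD(4,5)[OF assms(2)] that by (simp_all add: mem_I_iff)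
  have "AE x in \<nu>. max (u x) (v x) = 0" if \<nu>: "\<nu> \<in> N" for \<nu>
    using zero[OF \<nu>] by eventually_elim simp
  then show "CK_of_real (\<lambda>x. max (u x) (v x)) \<in> I"
    unfolding mem_I_iff ap by simp
qed

text \<open>Positivity and T1 = 1 preserve the bounds 0 and 1, and each ideal defining the kernel is
  invariant under \<open>T\<close>.\<close>

lemma unit_part_Markov:
  assumes "u \<in> unit_part I" "T \<in> S"
  shows "\<exists>v\<in>unit_part I. \<forall>x. apply_bcontfun (blinfun_apply T (CK_of_real u)) x = complex_of_real (v x)"
proof -
  have T: "Markov_operator T"
    using Markov assms(2) by simp
  let ?Tu = "blinfun_apply T (CK_of_real u)"
  note u = unit_partD[OF assms(1)]
  have "apply_bcontfun (CK_of_real u) x - apply_bcontfun (const_bcontfun 0) x \<in> \<real>\<^sub>\<ge>\<^sub>0" for x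
    by (simp add: u)
  from Markov_operator_mono[OF T this] have lo: "apply_bcontfun ?Tu x \<in> \<real>\<^sub>\<ge>\<^sub>0" for x
    by (simp add: Markov_operator_const[OF T])
  have "apply_bcontfun (const_bcontfun 1) x - apply_bcontfun (CK_of_real u) x \<in> \<real>\<^sub>\<ge>\<^sub>0" for x
    by (simp add: u complex_nonneg_Reals_iff)
  from Markov_operator_mono[OF T this] have hi: "1 - apply_bcontfun ?Tu x \<in> \<real>\<^sub>\<ge>\<^sub>0" for x
    by (simp add: Markov_operator_const[OF T])
  have eq: "apply_bcontfun ?Tu x = complex_of_real (Re (apply_bcontfun ?Tu x))" for x
    using lo[of x] by (simp add: complex_nonneg_Reals_iff complex_eq_iff)
  have "?Tu \<in> I"
    using u(4) invariant unfolding I_def by (auto intro!: ideal_of_invariant assms(2) T)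
  then have "(\<lambda>x. Re (apply_bcontfun ?Tu x)) \<in> unit_part I"
    unfolding unit_part_def using lo hi by (auto simp: complex_nonneg_Reals_iff intro!: bexI eq)
  with eq show ?thesis
    by (intro bexI[where x="\<lambda>x. Re (apply_bcontfun ?Tu x)"]) auto
qed

text \<open>An exhaustion argument: closure under maxima makes a maximizing sequence increasing. The
  pointwise limit \<open>h\<close> need not be continuous.\<close>

lemma unit_part_limit:
  assumes M: "M \<in> invariant_probs S"
  obtains f h s where "\<And>n. f n \<in> unit_part I" "\<And>x. incseq (\<lambda>n. f n x)"
    "\<And>x. (\<lambda>n. f n x) \<longlonglongrightarrow> h x" "\<And>u. u \<in> unit_part I \<Longrightarrow> (LINT x|M. u x) \<le> s"
    "(\<lambda>n. LINT x|M. f n x) \<longlonglongrightarrow> s"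
proof -
  interpret prob_space M
    using M by (rule invariant_probsD)
  note int = unit_part_integrable[OF invariant_probsD(1,2)[OF M]]
  let ?J = "(\<lambda>u. LINT x|M. u x) ` unit_part I"
  have "integral\<^sup>L M u \<le> 1" if "u \<in> unit_part I" for u
    using integral_mono[OF int[OF that], of "\<lambda>_. 1"] unit_partD(2)[OF that] by (simp add: prob_space)
  then have bdd: "bdd_above ?J"
    by (auto simp: bdd_above_def)
  have "apply_bcontfun (CK_of_real (\<lambda>_. 0)) x = 0" for x :: 'k
    by (subst apply_CK_of_real[where B=0]) auto
  then have "CK_of_real (\<lambda>_. 0) \<in> I"
    by (simp add: mem_I_iff)
  then have "(\<lambda>_. 0) \<in> unit_part I"
    by (intro unit_partI) auto
  then have ne: "?J \<noteq> {}"
    by blast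
  define s where "s = Sup ?J"
  have s: "(LINT x|M. u x) \<le> s" if "u \<in> unit_part I" for u
    unfolding s_def using that bdd by (auto intro: cSup_upper)
  have "\<exists>u\<in>unit_part I. s - 1 / real (Suc n) < (LINT x|M. u x)" for n
    using less_cSup_iff[OF ne bdd, of "s - 1 / real (Suc n)"] by (auto simp: s_def)
  then obtain g where g: "\<And>n. g n \<in> unit_part I" "\<And>n. s - 1 / real (Suc n) < (LINT x|M. g n x)"
    by metis
  \<comment> \<open>Running maxima of \<open>g\<close>: they stay in \<open>unit_part I\<close> and
    dominate \<open>g n\<close>, so their integrals still tend to \<open>s\<close>.\<close>
  define f where "f = rec_nat (g 0) (\<lambda>n u x. max (u x) (g (Suc n) x))"
  have f: "f n \<in> unit_part I" for n
    by (induction n) (auto simp: f_def g intro: unit_part_max)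
  have inc: "incseq (\<lambda>n. f n x)" for x
    by (rule incseq_SucI) (simp add: f_def)
  have gf: "g n x \<le> f n x" for n x
    by (cases n) (auto simp: f_def)
  have "(\<lambda>n. LINT x|M. f n x) \<longlonglongrightarrow> s"
  proof (rule tendsto_sandwich)
    have "s - 1 / real (Suc n) \<le> (LINT x|M. f n x)" for n
      using g(2)[of n] integral_mono[OF int[OF g(1)] int[OF f] gf, of n] by linarith
    then show "\<forall>\<^sub>F n in sequentially. s - 1 / real (Suc n) \<le> (LINT x|M. f n x)"
      by (rule always_eventually[OF allI])
    show "\<forall>\<^sub>F n in sequentially. (LINT x|M. f n x) \<le> s"
      using s f by simp
    show "(\<lambda>n. s - 1 / real (Suc n)) \<longlonglongrightarrow> s"
      using tendsto_diff[OF tendsto_const LIMSEQ_inverse_real_of_nat, of s]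
      by (simp add: inverse_eq_divide)
  qed simp
  moreover have "(\<lambda>n. f n x) \<longlonglongrightarrow> (SUP n. f n x)" for x
    by (intro LIMSEQ_incseq_SUP inc bdd_aboveI2[of _ _ 1] unit_partD(2)[OF f])
  ultimately show thesis
    by (intro that[OF f inc _ s])
qed

lemma limit_constant:
  assumes M: "M \<in> invariant_probs S" "ergodic S M" and nsub: "\<not> I \<subseteq> ideal_of M"
  obtains f and c :: real where "\<And>n. f n \<in> unit_part I" "AE x in M. (\<lambda>n. f n x) \<longlonglongrightarrow> c" "c > 0"
proof -
  interpret prob_space M
    using M(1) by (rule invariant_probsD)
  note MI = invariant_probsD(1,2)[OF M(1)]
  note int = unit_part_integrable[OF MI]
  obtain f h s where f: "\<And>n. f n \<in> unit_part I" and inc: "\<And>x. incseq (\<lambda>n. f n x)"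
    and lim: "\<And>x. (\<lambda>n. f n x) \<longlonglongrightarrow> h x"
    and s: "\<And>u. u \<in> unit_part I \<Longrightarrow> (LINT x|M. u x) \<le> s"
    and fs: "(\<lambda>n. LINT x|M. f n x) \<longlonglongrightarrow> s"
    using unit_part_limit[OF M(1)] by blast
  note bd = unit_partD(1,2)[OF f]
  have fh: "f n x \<le> h x" for n x
    by (rule incseq_le[OF inc lim])
  have h01: "0 \<le> h x" "h x \<le> 1" for x
    using order_trans[OF bd(1) fh] LIMSEQ_le_const2[OF lim, of _ 1] bd(2) by auto
  have hm [measurable]: "h \<in> borel_measurable M"
    by (rule borel_measurable_LIMSEQ_real[OF lim]) (use int[OF f] in auto)
  have hint: "integrable M h"
    by (rule integrable_const_bound[where B=1]) (use h01 in auto)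
  \<comment> \<open>Since \<open>h\<close> itself need not lie in \<open>unit_part I\<close>, the
    bound \<open>s\<close> on integrals reaches \<open>max (u x) (h x)\<close> only through this
    dominated limit.\<close>
  have maxlim: "(\<lambda>m. LINT x|M. max (u x) (f m x)) \<longlonglongrightarrow> (LINT x|M. max (u x) (h x))"
    if u: "u \<in> unit_part I" for u
  proof (rule integral_dominated_convergence[where w="\<lambda>_. 1"])
    show "(\<lambda>x. max (u x) (h x)) \<in> borel_measurable M"
      using int[OF u] by measurable
    show "(\<lambda>x. max (u x) (f m x)) \<in> borel_measurable M" for m
      using int[OF u] int[OF f, of m] by measurable
    show "AE x in M. (\<lambda>m. max (u x) (f m x)) \<longlonglongrightarrow> max (u x) (h x)"
      by (intro AE_I2 tendsto_max lim tendsto_const)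
    show "AE x in M. norm (max (u x) (f m x)) \<le> 1" for m
      using bd unit_partD(1,2)[OF u] by (intro AE_I2) (simp add: abs_le_iff max_def)
  qed simp
  have hs: "(LINT x|M. h x) = s"
  proof -
    \<comment> \<open>The choice \<open>u = f 0\<close> lies below every \<open>f m\<close> and
      below \<open>h\<close>, so both maxima disappear from \<open>maxlim\<close>.\<close>
    have "max (f 0 x) (f m x) = f m x" for m x
      using inc[of x] by (simp add: incseq_def max_absorb2)
    moreover have "max (f 0 x) (h x) = h x" for x
      using fh by (simp add: max_absorb2)
    ultimately have "(\<lambda>m. LINT x|M. f m x) \<longlonglongrightarrow> (LINT x|M. h x)"
      using maxlim[OF f, of 0] by simp
    then show ?thesis
      using fs LIMSEQ_unique by blast
  qed
  \<comment> \<open>Maximality: the maximum of \<open>u\<close> and \<open>h\<close> is at least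
    \<open>h\<close>, but its integral is at most \<open>s\<close>, the integral of
    \<open>h\<close>; hence the two agree almost everywhere.\<close>
  have le_h: "AE x in M. u x \<le> h x" if u: "u \<in> unit_part I" for u
  proof -
    have mint: "integrable M (\<lambda>x. max (u x) (h x))"
      using int[OF u] hint by (rule integrable_max)
    have "(LINT x|M. max (u x) (h x)) \<le> s"
      by (rule LIMSEQ_le_const2[OF maxlim[OF u]]) (auto intro: s unit_part_max u f)
    then have "(LINT x|M. max (u x) (h x) - h x) \<le> 0"
      using mint hint hs by simp
    moreover have "(LINT x|M. max (u x) (h x) - h x) \<ge> 0"
      by (intro integral_nonneg_AE) auto
    ultimately have "AE x in M. max (u x) (h x) - h x = 0"
      using integral_nonneg_eq_0_iff_AE[of M "\<lambda>x. max (u x) (h x) - h x"] mint hint by simp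
    then show ?thesis
      by eventually_elim simp
  qed
  let ?h = "\<lambda>x. complex_of_real (h x)"
  \<comment> \<open>As \<open>u\<close> lies below \<open>h\<close> almost everywhere, the L1
    distance is a difference of integrals.\<close>
  have L1: "(LINT x|M. cmod (complex_of_real (u x) - ?h x)) = s - (LINT x|M. u x)"
    if u: "u \<in> unit_part I" for u
  proof -
    have "(LINT x|M. cmod (complex_of_real (u x) - ?h x)) = (LINT x|M. h x - u x)"
    proof (rule integral_cong_AE)
      show "AE x in M. cmod (complex_of_real (u x) - ?h x) = h x - u x"
        using le_h[OF u] by eventually_elim (simp flip: of_real_diff)
    qed (use int[OF u] in measurable)
    then show ?thesis
      using int[OF u] hint hs by simp
  qed
  have to0: "(\<lambda>n. s - (LINT x|M. f n x)) \<longlonglongrightarrow> 0"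
    using tendsto_diff[OF tendsto_const fs, of s] by simp
  have "?h \<in> L1_fixed_space S M"
  proof (rule L1_fixed_spaceI[OF M(1) Markov, where f="\<lambda>n. CK_of_real (f n)"])
    show "integrable M ?h"
      using hint by simp
    show "L1_tendsto M (\<lambda>n. apply_bcontfun (CK_of_real (f n))) ?h"
      using to0 by (simp add: L1_tendsto_def unit_partD(5)[OF f] L1[OF f])
  next
    fix T assume T: "T \<in> S"
    \<comment> \<open>The image of \<open>f n\<close> again lies in \<open>unit_part I\<close> and
      has the same integral, so its distance to \<open>h\<close> is that of
      \<open>f n\<close>.\<close>
    have "(LINT x|M. cmod (apply_bcontfun (blinfun_apply T (CK_of_real (f n))) x - ?h x))
        = s - (LINT x|M. f n x)" for n
    proof -
      obtain v where v: "v \<in> unit_part I"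
        "\<And>x. apply_bcontfun (blinfun_apply T (CK_of_real (f n))) x = complex_of_real (v x)"
        using unit_part_Markov[OF f T] by blast
      have "complex_of_real (LINT x|M. v x) = complex_of_real (LINT x|M. f n x)"
        using invariant_probsD(3)[OF M(1) T, of "CK_of_real (f n)"]
        by (simp add: pairing_def v(2) unit_partD(5)[OF f])
      then show ?thesis
        using L1[OF v(1)] by (simp add: v(2))
    qed
    then show "L1_tendsto M (\<lambda>n. apply_bcontfun (blinfun_apply T (CK_of_real (f n)))) ?h"
      using to0 by (simp add: L1_tendsto_def)
  qed
  then obtain a where "AE x in M. ?h x = a"
    using ergodic_constant[OF M(1) Markov M(2)] by blast
  then have hc: "AE x in M. h x = Re a"
    by eventually_elim auto
  then have "(LINT x|M. h x) = (LINT x|M. Re a)"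
    by (intro integral_cong_AE) auto
  \<comment> \<open>On a probability space a constant equals its integral, so only the positivity of
    \<open>s\<close> remains to be shown.\<close>
  then have sa: "s = Re a"
    using hs by (simp add: prob_space)
  have "0 < s"
  proof (rule ccontr)
    assume "\<not> 0 < s"
    obtain g where g: "g \<in> I" "g \<notin> ideal_of M"
      using nsub by blast
    \<comment> \<open>Truncating |g| at 1 keeps its zeros. If \<open>s\<close> were not positive,
      \<open>u\<close> and hence \<open>g\<close> would vanish almost everywhere, contrary to the
      choice of \<open>g\<close>.\<close>
    define u where "u x = min 1 (cmod (apply_bcontfun g x))" for x
    have cont: "continuous_on UNIV u"
      unfolding u_def by (intro continuous_intros continuous_on_apply_bcontfun_UNIV)
    have ap: "apply_bcontfun (CK_of_real u) x = complex_of_real (u x)" for x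
      by (rule apply_CK_of_real[OF cont, of 1]) (simp add: u_def)
    have "CK_of_real u \<in> I"
      using g(1) by (auto simp: mem_I_iff ap u_def elim!: eventually_mono)
    then have u: "u \<in> unit_part I"
      by (intro unit_partI cont) (auto simp: u_def)
    have "(LINT x|M. u x) = 0"
      using s[OF u] \<open>\<not> 0 < s\<close> Bochner_Integration.integral_nonneg[of M u] unit_partD(1)[OF u]
      by fastforce
    then have "AE x in M. u x = 0"
      using integral_nonneg_eq_0_iff_AE[OF int[OF u]] unit_partD(1)[OF u] by simp
    then have "AE x in M. apply_bcontfun g x = 0"
      by eventually_elim (simp add: u_def min_def split: if_splits)
    then show False
      using g(2) ideal_of_iff[OF MI] by blast
  qed
  moreover have "AE x in M. (\<lambda>n. f n x) \<longlonglongrightarrow> s"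
    using hc by eventually_elim (metis lim sa)
  ultimately show thesis
    using that f by blast
qed

end

text \<open>Two positive constant limits cannot come from sequences whose pointwise minima vanish
  almost everywhere.\<close>

lemma ideal_of_ergodic_prime:
  assumes Markov: "\<forall>T\<in>S. Markov_operator T"
    and N: "N1 \<subseteq> invariant_probs S" "N2 \<subseteq> invariant_probs S"
    and M: "M \<in> invariant_probs S" "ergodic S M"
    and sub: "(\<Inter>\<nu>\<in>N1. ideal_of \<nu>) \<inter> (\<Inter>\<nu>\<in>N2. ideal_of \<nu>) \<subseteq> ideal_of M"
  shows "(\<Inter>\<nu>\<in>N1. ideal_of \<nu>) \<subseteq> ideal_of M \<or> (\<Inter>\<nu>\<in>N2. ideal_of \<nu>) \<subseteq> ideal_of M"
proof (rule ccontr)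
  interpret prob_space M
    using M(1) by (rule invariant_probsD)
  interpret k1: Markov_kernel S N1
    by unfold_locales (use Markov N in auto)
  interpret k2: Markov_kernel S N2
    by unfold_locales (use Markov N in auto)
  assume "\<not> ?thesis"
  then have ns: "\<not> k1.I \<subseteq> ideal_of M" "\<not> k2.I \<subseteq> ideal_of M"
    by (simp_all add: k1.I_def k2.I_def)
  obtain f c where f: "\<And>n. f n \<in> unit_part k1.I" "AE x in M. (\<lambda>n. f n x) \<longlonglongrightarrow> c" "c > (0::real)"
    using k1.limit_constant[OF M ns(1)] by blast
  obtain g d where g: "\<And>n. g n \<in> unit_part k2.I" "AE x in M. (\<lambda>n. g n x) \<longlonglongrightarrow> d" "d > (0::real)"
    using k2.limit_constant[OF M ns(2)] by blast
  have "AE x in M. min (f n x) (g n x) = 0" for n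
  proof -
    have 1: "(\<lambda>x. min (f n x) (g n x)) \<in> unit_part k1.I"
      by (rule k1.unit_part_minI[OF f(1) unit_partD(3,1)[OF g(1)]])
    have "(\<lambda>x. min (g n x) (f n x)) \<in> unit_part k2.I"
      by (rule k2.unit_part_minI[OF g(1) unit_partD(3,1)[OF f(1)]])
    then have 2: "(\<lambda>x. min (f n x) (g n x)) \<in> unit_part k2.I"
      by (simp add: min.commute)
    have "CK_of_real (\<lambda>x. min (f n x) (g n x)) \<in> ideal_of M"
      using unit_partD(4)[OF 1] unit_partD(4)[OF 2] sub by (auto simp: k1.I_def k2.I_def)
    then show ?thesis
      by (simp add: ideal_of_iff[OF invariant_probsD(1,2)[OF M(1)]] unit_partD(5)[OF 1])
  qed
  \<comment> \<open>Countably many null sets are merged, so that the limit can be taken at a single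
    point.\<close>
  then have "AE x in M. \<forall>n. min (f n x) (g n x) = 0"
    by (simp add: AE_all_countable)
  \<comment> \<open>The assertion does not involve \<open>x\<close>; on a probability space it then
    holds outright.\<close>
  with f(2) g(2) have "AE x in M. min c d = 0"
  proof eventually_elim
    case (elim x)
    then have "(\<lambda>n. 0) \<longlonglongrightarrow> min c d"
      using tendsto_min[OF elim(1,2)] by simp
    then show ?case
      by (simp add: LIMSEQ_const_iff)
  qed
  then show False
    using f(3) g(3) by (simp add: min_def split: if_splits)
qed

section \<open>Hulls, kernels and the closure axioms\<close>

lemma prim_ker_eq:
  assumes "A \<subseteq> Prim S"
  obtains N where "N \<subseteq> invariant_probs S" "prim_ker A = (\<Inter>\<nu>\<in>N. ideal_of \<nu>)"
proof -
  \<comment> \<open>Taking every invariant measure whose ideal lies in \<open>A\<close> avoids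
    choosing representatives.\<close>
  let ?N = "{M \<in> invariant_probs S. ideal_of M \<in> A}"
  have "A = ideal_of ` ?N"
    using assms by (fastforce simp: Prim_def)
  then have "prim_ker A = (\<Inter>\<nu>\<in>?N. ideal_of \<nu>)"
    unfolding prim_ker_def by metis
  then show thesis
    using that[of ?N] by blast
qed

theorem proposition5p3:
  fixes S :: "'k::t2_space CK_op set"
  assumes "compact (UNIV :: 'k set)"
    and "operator_semigroup S"
    and "\<forall>T\<in>S. Markov_operator T"
    and "right_amenable S"
  shows "Kuratowski_closure_operator (Prim S) (\<lambda>A. prim_hull S (prim_ker A))"
proof -
  \<comment> \<open>The kernel of the empty family is all of C(K), so the closure of the empty set
    is empty once primitive ideals are proper.\<close>
  have "p \<noteq> UNIV" if p: "p \<in> Prim S" for p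
  proof -
    obtain M where M: "M \<in> invariant_probs S" "p = ideal_of M"
      using p by (auto simp: Prim_def)
    interpret prob_space M
      using M(1) by (rule invariant_probsD)
    have "const_bcontfun 1 \<notin> p"
      by (simp add: M(2) ideal_of_def prob_space)
    then show ?thesis
      by blast
  qed
  then have empty: "prim_hull S (prim_ker {}) = {}"
    by (auto simp: prim_hull_def prim_ker_def)
  have union: "prim_hull S (prim_ker (A \<union> B)) = prim_hull S (prim_ker A) \<union> prim_hull S (prim_ker B)"
    if A: "A \<subseteq> Prim S" and B: "B \<subseteq> Prim S" for A B
  proof
    show "prim_hull S (prim_ker A) \<union> prim_hull S (prim_ker B) \<subseteq> prim_hull S (prim_ker (A \<union> B))"
      by (auto simp: prim_hull_def prim_ker_def)
    show "prim_hull S (prim_ker (A \<union> B)) \<subseteq> prim_hull S (prim_ker A) \<union> prim_hull S (prim_ker B)"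
    proof
      fix p assume p: "p \<in> prim_hull S (prim_ker (A \<union> B))"
      then obtain M where M: "M \<in> invariant_probs S" "ergodic S M" "p = ideal_of M"
        by (auto simp: prim_hull_def Prim_def)
      obtain N1 where N1: "N1 \<subseteq> invariant_probs S" "prim_ker A = (\<Inter>\<nu>\<in>N1. ideal_of \<nu>)"
        using prim_ker_eq[OF A] .
      obtain N2 where N2: "N2 \<subseteq> invariant_probs S" "prim_ker B = (\<Inter>\<nu>\<in>N2. ideal_of \<nu>)"
        using prim_ker_eq[OF B] .
      have "prim_ker A \<inter> prim_ker B \<subseteq> p"
        using p by (auto simp: prim_hull_def prim_ker_def)
      then have "prim_ker A \<subseteq> p \<or> prim_ker B \<subseteq> p"
        using ideal_of_ergodic_prime[OF assms(3) N1(1) N2(1) M(1,2)] N1(2) N2(2) M(3) by simp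
      then show "p \<in> prim_hull S (prim_ker A) \<union> prim_hull S (prim_ker B)"
        using p by (auto simp: prim_hull_def)
    qed
  qed
  \<comment> \<open>The other axioms are formal consequences of the Galois connection between hulls
    and kernels.\<close>
  show ?thesis
    unfolding Kuratowski_closure_operator_def
    using empty union by (auto simp: prim_hull_def prim_ker_def)
qed

end
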